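(* For every integer $n \geq 4$, the $n$-gear graph $G_n$ satisfies $rn(G_n) \geq 4n+2$.
   Context: All graphs are simple and connected; $d(u,v)$ is the graph distance and $\operatorname{diam}(G)$ the diameter. A radio labeling of $G$ is a one-to-one map $c: V(G) \to \mathbb{Z}_{+}$ (positive integers) such that $d(u,v) + |c(u)-c(v)| \geq \operatorname{diam}(G)+1$ for all distinct $u,v \in V(G)$. The span of $c$ is the maximum value of $c$; the radio number $rn(G)$ is the minimum span over all radio labelings of $G$. The $n$-gear $G_n$ is the graph consisting of a cycle on $2n$ vertices together with an additional center vertex adjacent to every other vertex of the cycle; it has $2n+1$ vertices and $3n$ edges. *)

theory Defs
  imports "Graph_Theory.Graph_Theory"
begin

definition gdist :: "('a, 'b) pre_digraph \<Rightarrow> 'a \<Rightarrow> 'a \<Rightarrow> nat" where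
  "gdist G u v = (LEAST k. \<exists>p. pre_digraph.awalk G u p v \<and> length p = k)"

text \<open>On connected pairs this is the shortest-path cost with unit arc weights.\<close>

lemma (in wf_digraph) gdist_eq_\<mu>:
  assumes "u \<rightarrow>\<^sup>* v"
  shows "ereal (real (gdist G u v)) = \<mu> (\<lambda>_. 1) u v"
proof -
  have cost: "awalk_cost (\<lambda>_. 1) p = real (length p)" for p :: "'b awalk"
    by (induction p) auto
  let ?P = "\<lambda>k. \<exists>p. awalk u p v \<and> length p = k"
  obtain q where "awalk u q v" using assms by (auto simp: reachable_awalk)
  then have "?P (length q)" by blast
  then have "?P (gdist G u v)" unfolding gdist_def by (rule LeastI)
  then obtain p where p: "awalk u p v" "length p = gdist G u v" by blast
  have le: "gdist G u v \<le> length r" if "awalk u r v" for r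
    unfolding gdist_def using that by (intro Least_le) blast
  show ?thesis
    unfolding \<mu>_def cost
  proof (intro antisym INF_greatest)
    show "(INF p\<in>{p. awalk u p v}. ereal (real (length p))) \<le> ereal (real (gdist G u v))"
      using p by (intro INF_lower2[of p]) auto
  qed (use le in auto)
qed

definition graph_diam :: "('a, 'b) pre_digraph \<Rightarrow> nat" where
  "graph_diam G = Max {gdist G u v | u v. u \<in> verts G \<and> v \<in> verts G}"

text \<open>Labels are natural numbers; values of \<open>c\<close> outside \<open>verts G\<close> are irrelevant.\<close>

definition radio_labeling :: "('a, 'b) pre_digraph \<Rightarrow> ('a \<Rightarrow> nat) \<Rightarrow> bool" where
  "radio_labeling G c \<longleftrightarrow>
     (\<forall>v \<in> verts G. 0 < c v) \<and> inj_on c (verts G) \<and>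
     (\<forall>u \<in> verts G. \<forall>v \<in> verts G. u \<noteq> v \<longrightarrow>
        int (gdist G u v) + \<bar>int (c u) - int (c v)\<bar> \<ge> int (graph_diam G) + 1)"

definition label_span :: "('a, 'b) pre_digraph \<Rightarrow> ('a \<Rightarrow> nat) \<Rightarrow> nat" where
  "label_span G c = Max (c ` verts G)"

definition radio_number :: "('a, 'b) pre_digraph \<Rightarrow> nat" where
  "radio_number G = (LEAST s. \<exists>c. radio_labeling G c \<and> label_span G c = s)"

datatype gear_vertex = Center | Rim nat

text \<open>
  Undirected graphs are symmetric digraphs: every edge contributes both of its orientations.
  The rim vertices are numbered cyclically, and the center is adjacent to the even ones.
\<close>

definition gear_edges :: "nat \<Rightarrow> gear_vertex rel" where
  "gear_edges n =
     {(Rim i, Rim (Suc i mod (2 * n))) | i. i < 2 * n} \<union>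
     {(Center, Rim i) | i. i < 2 * n \<and> even i}"

definition gear :: "nat \<Rightarrow> gear_vertex pair_pre_digraph" where
  "gear n = \<lparr> pverts = insert Center (Rim ` {..<2 * n}),
              parcs = gear_edges n \<union> (gear_edges n)\<inverse> \<rparr>"

lemma gear_simps:
  "pverts (gear n) = insert Center (Rim ` {..<2 * n})"
  "parcs (gear n) = gear_edges n \<union> (gear_edges n)\<inverse>"
  by (simp_all add: gear_def)

lemma finite_gear_edges: "finite (gear_edges n)"
  by (simp add: gear_edges_def)

lemma Suc_mod_neq: "i < 2 * n \<Longrightarrow> Suc i mod (2 * n) \<noteq> i"
  by (cases "Suc i = 2 * n"; cases i) auto

lemma pair_graph_gear: "pair_graph (gear n)"
proof
  fix e assume e: "e \<in> parcs (gear n)"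
  show "fst e \<in> pverts (gear n)" "snd e \<in> pverts (gear n)"
    using e by (auto simp: gear_simps gear_edges_def)
  show "fst e \<noteq> snd e"
    using e by (auto simp: gear_simps gear_edges_def dest: Suc_mod_neq)
next
  show "finite (pverts (gear n))" "finite (parcs (gear n))"
    by (simp_all add: gear_simps finite_gear_edges)
  show "symmetric (with_proj (gear n))"
    by (auto simp: symmetric_def gear_simps sym_def)
qed

lemma card_verts_gear: "card (pverts (gear n)) = 2 * n + 1"
  by (subst gear_simps, subst card_insert_disjoint) (auto simp: card_image inj_on_def)

lemma strongly_connected_gear: "strongly_connected (with_proj (gear n))"
proof -
  interpret pair_graph "gear n" by (rule pair_graph_gear)
  let ?G = "with_proj (gear n)"
  have even: "Center \<rightarrow>\<^sup>*\<^bsub>?G\<^esub> Rim i" if "i < 2 * n" "even i" for i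
    using that by (intro reachable_adjI) (auto simp: gear_simps gear_edges_def)
  have "Center \<rightarrow>\<^sup>*\<^bsub>?G\<^esub> Rim i" if i: "i < 2 * n" "odd i" for i
  proof -
    from i obtain j where j: "i = Suc j" "even j" by (cases i) auto
    have "Rim j \<rightarrow>\<^bsub>?G\<^esub> Rim i"
      using i j by (auto simp: gear_simps gear_edges_def intro!: exI[of _ j])
    with even[of j] i j show ?thesis
      by (auto intro: reachable_adj_trans)
  qed
  with even have "Center \<rightarrow>\<^sup>*\<^bsub>?G\<^esub> v" if "v \<in> pverts (gear n)" for v
    using that by (auto simp: gear_simps)
  then show ?thesis
    by (intro strongly_connectedI)
       (auto simp: gear_simps intro: reachable_trans symmetric_reachable[OF sym_arcs])
qed

text \<open>Each edge gives two arcs, so this says that the gear has \<open>3n\<close> edges.\<close>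

lemma card_arcs_gear:
  assumes "n \<ge> 2"
  shows "card (parcs (gear n)) = 2 * (3 * n)"
proof -
  let ?A = "(\<lambda>i. (Rim i, Rim (Suc i mod (2 * n)))) ` {..<2 * n}"
  let ?B = "(\<lambda>i. (Center, Rim (2 * i))) ` {..<n}"
  have E: "gear_edges n = ?A \<union> ?B"
    by (auto simp: gear_edges_def image_iff elim!: evenE)
  have "card ?A = 2 * n" by (subst card_image) (auto simp: inj_on_def)
  moreover have "card ?B = n" by (subst card_image) (auto simp: inj_on_def)
  moreover have "?A \<inter> ?B = {}" by auto
  ultimately have cE: "card (gear_edges n) = 3 * n"
    unfolding E by (subst card_Un_disjoint) auto
  have "Suc (Suc i mod (2 * n)) mod (2 * n) \<noteq> i" if "i < 2 * n" for i
    using that assms by (auto simp: mod_Suc split: if_splits)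
  then have "gear_edges n \<inter> (gear_edges n)\<inverse> = {}"
    by (auto simp: gear_edges_def) metis
  then show ?thesis
    by (simp add: gear_simps card_Un_disjoint finite_gear_edges cE)
qed

text \<open>The least element in the definition of the radio number exists.\<close>

lemma radio_labeling_exists:
  assumes "finite (verts G)"
  shows "\<exists>c. radio_labeling G c"
proof -
  obtain f :: "_ \<Rightarrow> nat" where f: "inj_on f (verts G)"
    using finite_imp_inj_to_nat_seg[OF assms] by blast
  define D where "D = graph_diam G + 1"
  define c where "c v = D * (f v + 1)" for v
  have D: "D > 0" by (simp add: D_def)
  have "int (gdist G u v) + \<bar>int (c u) - int (c v)\<bar> \<ge> int (graph_diam G) + 1"
    if "u \<in> verts G" "v \<in> verts G" "u \<noteq> v" for u v
  proof -
    have "f u \<noteq> f v" using f that by (auto dest: inj_onD)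
    then have "1 \<le> \<bar>int (f u) - int (f v)\<bar>" by linarith
    then have "int D * 1 \<le> int D * \<bar>int (f u) - int (f v)\<bar>"
      by (intro mult_left_mono) auto
    also have "\<dots> = \<bar>int (c u) - int (c v)\<bar>"
      using abs_mult[of "int D" "int (f u) - int (f v)"]
      by (simp add: c_def algebra_simps)
    finally show ?thesis by (simp add: D_def)
  qed
  moreover have "inj_on c (verts G)"
    using f D by (auto simp: inj_on_def c_def)
  ultimately have "radio_labeling G c"
    using D by (auto simp: radio_labeling_def c_def)
  then show ?thesis by blast
qed

end

theory Submission
  imports Defs
begin

text \<open>
  Give the center level 0, the even rim vertices level 1 and the odd ones level 2, so that routing
  through the center yields \<open>d(u,v) \<le> level u + level v\<close>. The diameter is at least 4, hence
  consecutive vertices in the order of their labels have labels differing by at least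
  \<open>5 - level u - level v\<close>. Summing these \<open>2n\<close> gaps counts every level twice except those of the
  first and the last vertex. As the levels add up to \<open>3n\<close> and only the center has level 0, the
  labels spread over at least \<open>10n - 6n + 1\<close>.
\<close>

lemma gdist_le_length:
  assumes "pre_digraph.awalk G u p v"
  shows "gdist G u v \<le> length p"
  unfolding gdist_def using assms by (intro Least_le) blast

text \<open>\<open>LEAST\<close> says something only when some walk exists; reachability supplies
  one, so the minimum is attained.\<close>

lemma (in wf_digraph) gdist_awalk_obtain:
  assumes "u \<rightarrow>\<^sup>* v"
  obtains p where "awalk u p v" "length p = gdist G u v"
proof -
  from assms obtain q where "awalk u q v" by (auto simp: reachable_awalk)
  then have "\<exists>k p. awalk u p v \<and> length p = k" by blast
  from LeastI_ex[OF this] show ?thesis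
    unfolding gdist_def[symmetric] using that by blast
qed

text \<open>The tool for bounding distances from below: one function that rises by at most 1 per arc
  replaces an inspection of all walks.\<close>

lemma (in wf_digraph) awalk_potential_le:
  assumes "\<And>e. e \<in> arcs G \<Longrightarrow> f (head G e) \<le> f (tail G e) + (1::nat)"
    and "awalk u p v"
  shows "f v \<le> f u + length p"
  using assms(2)
proof (induction p arbitrary: u)
  case Nil
  then show ?case by (simp add: awalk_Nil_iff)
next
  case (Cons e p)
  then have "e \<in> arcs G" "tail G e = u" "awalk (head G e) p v"
    by (auto simp: awalk_Cons_iff)
  with Cons.IH[of "head G e"] assms(1)[of e] show ?case by simp
qed

lemma gdist_le_graph_diam:
  assumes "finite (verts G)" "u \<in> verts G" "v \<in> verts G"
  shows "gdist G u v \<le> graph_diam G"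
proof -
  have "{gdist G u v | u v. u \<in> verts G \<and> v \<in> verts G}
      = (\<lambda>(u, v). gdist G u v) ` (verts G \<times> verts G)"
    by auto
  then have "finite {gdist G u v | u v. u \<in> verts G \<and> v \<in> verts G}"
    using assms(1) by simp
  then show ?thesis
    unfolding graph_diam_def using assms(2,3) by (intro Max_ge) auto
qed

text \<open>Elements enter in order of nondecreasing \<open>c\<close>, so \<open>a\<close> stays the
  first and \<open>b\<close> is always the latest. The clause on \<open>a = b\<close> serves to show
  later that the two ends cannot both have level 0.\<close>

lemma sum_of_label_gaps:
  fixes c l :: "'a \<Rightarrow> int"
  assumes "finite S" "S \<noteq> {}"
    and "\<And>u v. u \<in> S \<Longrightarrow> v \<in> S \<Longrightarrow> u \<noteq> v \<Longrightarrow> D \<le> l u + l v + \<bar>c u - c v\<bar>"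
  shows "\<exists>a\<in>S. \<exists>b\<in>S. (a = b \<longrightarrow> S = {a}) \<and>
           D * (int (card S) - 1) - 2 * sum l S + l a + l b \<le> c b - c a"
  using assms
proof (induction S rule: finite_ranking_induct[where f = c])
  case empty
  then show ?case by simp
next
  case (insert x S)
  \<comment> \<open>The induction rule allows the new element to lie in \<open>S\<close> already.
    For empty \<open>S\<close>, \<open>a = b = x\<close> turns the bound into
    \<open>0 \<le> 0\<close>.\<close>
  consider "S = {}" | "x \<in> S" | "S \<noteq> {}" "x \<notin> S" by blast
  then show ?case
  proof cases
    case 1
    then show ?thesis by simp
  next
    case 2
    then have "insert x S = S" by blast
    with 2 insert.IH insert.prems show ?thesis by auto
  next
    case 3
    have "\<exists>a\<in>S. \<exists>b\<in>S. (a = b \<longrightarrow> S = {a}) \<and>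
      D * (int (card S) - 1) - 2 * sum l S + l a + l b \<le> c b - c a"
      by (rule insert.IH) (use 3 insert.prems in auto)
    then obtain a b where ab: "a \<in> S" "b \<in> S"
      "D * (int (card S) - 1) - 2 * sum l S + l a + l b \<le> c b - c a"
      by blast
    have "D \<le> l x + l b + \<bar>c x - c b\<bar>"
      using insert.prems 3 ab by auto
    \<comment> \<open>The ranking removes the absolute value. Adding this gap to the bound for
      \<open>S\<close> cancels \<open>l b\<close> and makes \<open>x\<close> the new last
      element.\<close>
    moreover have "c b \<le> c x" using insert ab by auto
    ultimately have "D \<le> l x + l b + (c x - c b)" by simp
    moreover have "a \<noteq> x" "sum l (insert x S) = l x + sum l S"
      "int (card (insert x S)) = int (card S) + 1"
      using ab 3 insert.hyps by auto
    ultimately show ?thesis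
      using ab insert.hyps
      by (intro bexI[of _ a] bexI[of _ x]) (auto simp: algebra_simps)
  qed
qed

fun gear_level :: "gear_vertex \<Rightarrow> nat" where
  "gear_level Center = 0"
| "gear_level (Rim i) = (if even i then 1 else 2)"

lemma sum_gear_level: "sum gear_level (pverts (gear n)) = 3 * n"
proof -
  have "(\<Sum>i<2 * n. gear_level (Rim i)) = 3 * n"
    by (induction n) auto
  then show ?thesis
    by (subst gear_simps, subst sum.insert) (auto simp: sum.reindex inj_on_def)
qed

lemma gear_awalk_Center:
  assumes "v \<in> pverts (gear n)"
  shows "\<exists>p. pre_digraph.awalk (with_proj (gear n)) v p Center \<and> length p = gear_level v"
    and "\<exists>p. pre_digraph.awalk (with_proj (gear n)) Center p v \<and> length p = gear_level v"
proof -
  interpret pair_graph "gear n" by (rule pair_graph_gear)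
  \<comment> \<open>An odd rim vertex is reached from its even predecessor, so no index wraps around
    the cycle.\<close>
  consider "v = Center" | i where "v = Rim i" "i < 2 * n" "even i"
    | i where "v = Rim (Suc i)" "Suc i < 2 * n" "even i"
  proof -
    have "\<exists>j. i = Suc j \<and> even j" if "odd i" for i :: nat
      using that by (cases i) auto
    then show thesis
      using that assms unfolding gear_simps by blast
  qed
  then have "(\<exists>p. awalk v p Center \<and> length p = gear_level v) \<and>
    (\<exists>p. awalk Center p v \<and> length p = gear_level v)"
  proof cases
    case 1
    then show ?thesis by (auto simp: awalk_Nil_iff gear_simps)
  next
    case 2
    then have "awalk v [(v, Center)] Center" "awalk Center [(Center, v)] v"
      by (auto simp: awalk_simps gear_simps gear_edges_def)
    moreover have "gear_level v = 1" using 2 by simp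
    ultimately show ?thesis by (metis One_nat_def length_Cons list.size(3))
  next
    case 3
    then have "(Rim i, v) \<in> gear_edges n" "(Center, Rim i) \<in> gear_edges n"
      by (auto simp: gear_edges_def intro!: exI[of _ i])
    with 3 have "awalk v [(v, Rim i), (Rim i, Center)] Center"
        "awalk Center [(Center, Rim i), (Rim i, v)] v"
      by (auto simp: awalk_simps gear_simps)
    moreover have "gear_level v = length [(v, Rim i), (Rim i, Center)]"
      "gear_level v = length [(Center, Rim i), (Rim i, v)]" using 3 by simp_all
    ultimately show ?thesis by metis
  qed
  then show "\<exists>p. awalk v p Center \<and> length p = gear_level v"
    "\<exists>p. awalk Center p v \<and> length p = gear_level v" by auto
qed

lemma gdist_gear_le:
  assumes "u \<in> pverts (gear n)" "v \<in> pverts (gear n)"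
  shows "gdist (with_proj (gear n)) u v \<le> gear_level u + gear_level v"
proof -
  interpret pair_graph "gear n" by (rule pair_graph_gear)
  obtain p where p: "awalk u p Center" "length p = gear_level u"
    using gear_awalk_Center(1)[OF assms(1)] by blast
  obtain q where q: "awalk Center q v" "length q = gear_level v"
    using gear_awalk_Center(2)[OF assms(2)] by blast
  show ?thesis
    using gdist_le_length[OF awalk_appendI[OF p(1) q(1)]] p(2) q(2) by simp
qed

text \<open>The gear is bipartite, with the even rim vertices as one side. \<open>Rim 1\<close> and
  \<open>Rim 5\<close> have neighbours 0, 2 and 4, 6; these are distinct even vertices, hence two
  apart, which gives distance 4.\<close>

lemma graph_diam_gear_ge:
  assumes "n \<ge> 4"
  shows "graph_diam (with_proj (gear n)) \<ge> 4"
proof -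
  interpret pair_graph "gear n" by (rule pair_graph_gear)
  \<comment> \<open>the distance from \<open>Rim 1\<close>\<close>
  define f :: "gear_vertex \<Rightarrow> nat" where
    "f v = (case v of Center \<Rightarrow> 2 | Rim i \<Rightarrow>
       if i = 1 then 0 else if i = 0 \<or> i = 2 then 1 else if i = 3 \<or> i = 2 * n - 1 then 2
       else if even i then 3 else 4)" for v
  \<comment> \<open>Both directions are needed because every edge carries two arcs; the edge closing
    the cycle is treated separately.\<close>
  have rim: "f (Rim (Suc i mod (2 * n))) \<le> f (Rim i) + 1 \<and>
      f (Rim i) \<le> f (Rim (Suc i mod (2 * n))) + 1" if "i < 2 * n" for i
  proof (cases "Suc i = 2 * n")
    case True
    then show ?thesis using assms by (auto simp: f_def)
  next
    case False
    then show ?thesis using that assms by (auto simp: f_def) presburger+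
  qed
  have center: "f (Rim i) \<le> f Center + 1 \<and> f Center \<le> f (Rim i) + 1" if "even i" for i
    using that assms by (auto simp: f_def)
  have "f (snd e) \<le> f (fst e) + 1" if "e \<in> parcs (gear n)" for e
    using that rim center by (auto simp: gear_simps gear_edges_def)
  moreover have verts: "Rim 1 \<in> pverts (gear n)" "Rim 5 \<in> pverts (gear n)"
    using assms by (auto simp: gear_simps)
  moreover have "Rim 1 \<rightarrow>\<^sup>*\<^bsub>with_proj (gear n)\<^esub> Rim 5"
    using strongly_connected_gear[of n] verts by (auto simp: strongly_connected_def)
  then obtain p where "awalk (Rim 1) p (Rim 5)"
    and p: "length p = gdist (with_proj (gear n)) (Rim 1) (Rim 5)"
    by (rule gdist_awalk_obtain)
  ultimately have "f (Rim 5) \<le> f (Rim 1) + length p"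
    by (intro awalk_potential_le[where f = f]) auto
  \<comment> \<open>Since \<open>n \<ge> 4\<close>, 5 differs from \<open>2 * n - 1\<close>, so
    \<open>f (Rim 5) = 4\<close>. For \<open>n = 3\<close> the two vertices would share the
    neighbour \<open>Rim 0\<close>.\<close>
  then have "4 \<le> gdist (with_proj (gear n)) (Rim 1) (Rim 5)"
    using assms p by (auto simp: f_def split: if_splits)
  also have "\<dots> \<le> graph_diam (with_proj (gear n))"
    using verts by (intro gdist_le_graph_diam) (auto simp: gear_simps)
  finally show ?thesis .
qed

theorem theorem2p1:
  fixes n :: nat
  assumes "n \<ge> 4"
  shows "radio_number (with_proj (gear n)) \<ge> 4 * n + 2"
proof -
  let ?G = "with_proj (gear n)" and ?V = "pverts (gear n)"
  have fin: "finite ?V" by (simp add: gear_simps)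
  have "\<exists>s c. radio_labeling ?G c \<and> label_span ?G c = s"
    using radio_labeling_exists[of ?G] fin by simp
  from LeastI_ex[OF this] have "\<exists>c. radio_labeling ?G c \<and> label_span ?G c = radio_number ?G"
    unfolding radio_number_def .
  then obtain c where c: "radio_labeling ?G c" "label_span ?G c = radio_number ?G"
    by blast
  have "5 \<le> int (gear_level u) + int (gear_level v) + \<bar>int (c u) - int (c v)\<bar>"
    if "u \<in> ?V" "v \<in> ?V" "u \<noteq> v" for u v
  proof -
    have "int (gdist ?G u v) + \<bar>int (c u) - int (c v)\<bar> \<ge> int (graph_diam ?G) + 1"
      using c(1) that by (simp add: radio_labeling_def)
    then show ?thesis
      using gdist_gear_le[OF that(1,2)] graph_diam_gear_ge[OF assms] by linarith
  qed
  moreover have "?V \<noteq> {}" by (simp add: gear_simps)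
  ultimately obtain a b where ab: "a \<in> ?V" "b \<in> ?V" "a = b \<longrightarrow> ?V = {a}"
    "5 * (int (card ?V) - 1) - 2 * (\<Sum>v\<in>?V. int (gear_level v))
       + int (gear_level a) + int (gear_level b) \<le> int (c b) - int (c a)"
    using sum_of_label_gaps[OF fin, of 5 "\<lambda>v. int (gear_level v)" "\<lambda>v. int (c v)"] by blast
  have sum: "(\<Sum>v\<in>?V. int (gear_level v)) = 3 * int n"
    using sum_gear_level[of n] by (simp flip: of_nat_sum)
  have card: "int (card ?V) = 2 * int n + 1"
    by (simp add: card_verts_gear)
  \<comment> \<open>Here \<open>5 * (2 * n) - 2 * (3 * n) = 4 * n\<close>.\<close>
  have "4 * int n + int (gear_level a) + int (gear_level b) \<le> int (c b) - int (c a)"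
    using ab(4) unfolding sum card by simp
  moreover have "a \<noteq> b"
    using ab(3) card_verts_gear[of n] assms by auto
  then have "1 \<le> gear_level a + gear_level b"
    by (cases a; cases b) auto
  \<comment> \<open>Labels start at 1, which provides the second unit of the \<open>+ 2\<close>; the
    first comes from the end levels.\<close>
  moreover have "0 < c a" using c(1) ab by (simp add: radio_labeling_def)
  moreover have "c b \<le> radio_number ?G"
    unfolding c(2)[symmetric] label_span_def using ab(2) fin by (intro Max_ge) auto
  ultimately show ?thesis by linarith
qed

end
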